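(* Let $r,m,p$ be positive integers. Then $$\zeta\bigl(\{1\}_r\circledast(1,\{\{1\}_{m-1},2\}_{p-1},\{1\}_m)^\star\bigr)=\sum_{n=1}^\infty \frac{\zeta_{n-1}(\{1\}_{r-1})\,\zeta_n^\star\bigl(\{\{1\}_{m-1},2\}_{p-1},\{1\}_m\bigr)}{n^2}\in\mathbb{Q}[\text{Riemann zeta values}],$$ i.e. this number is a polynomial with rational coefficients in the values $\zeta(2),\zeta(3),\zeta(4),\ldots$.
   Context: For a finite sequence (index) of positive integers $(k_1,\ldots,k_r)$ and $n\ge 0$, $\zeta_n(k_1,\ldots,k_r)=\sum_{n\ge n_1>\cdots>n_r\ge1}\prod_j n_j^{-k_j}$ and $\zeta_n^\star(k_1,\ldots,k_r)=\sum_{n\ge n_1\ge\cdots\ge n_r\ge1}\prod_j n_j^{-k_j}$, with $\zeta_n(\emptyset)=\zeta_n^\star(\emptyset)=1$. The Kaneko–Yamamoto multiple zeta value of indices $\mathbf k=(k_1,\ldots,k_r)$, $\mathbf l=(l_1,\ldots,l_s)$ is $$\zeta(\mathbf k\circledast\mathbf l^\star)=\sum_{n=1}^\infty\frac{\zeta_{n-1}(k_2,\ldots,k_r)\,\zeta_n^\star(l_2,\ldots,l_s)}{n^{k_1+l_1}}.$$ The notation $\{s_1,\ldots,s_j\}_d$ denotes the sequence $s_1,\ldots,s_j$ repeated $d$ times (empty if $d=0$); e.g. $\{\{1\}_{m-1},2\}_{p-1}$ is the block $(\underbrace{1,\ldots,1}_{m-1},2)$ repeated $p-1$ times. *)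

theory Defs
  imports Complex_Main
begin

text \<open>
  An index is a list of positive integers. In both sums below the summation variables are the
  entries of a list \<open>ns\<close> of the same length as the index; for the empty index the only
  such list is \<open>[]\<close>, contributing the empty product 1.
\<close>

definition mhs :: "nat \<Rightarrow> nat list \<Rightarrow> real" where
  "mhs n ks =
     (\<Sum>ns | length ns = length ks \<and> set ns \<subseteq> {1..n} \<and> sorted_wrt (>) ns.
        \<Prod>j<length ks. 1 / real (ns ! j) ^ (ks ! j))"

definition mhs_star :: "nat \<Rightarrow> nat list \<Rightarrow> real" where
  "mhs_star n ks =
     (\<Sum>ns | length ns = length ks \<and> set ns \<subseteq> {1..n} \<and> sorted_wrt (\<ge>) ns.
        \<Prod>j<length ks. 1 / real (ns ! j) ^ (ks ! j))"

text \<open>The \<open>n\<close>-th term (\<open>n \<ge> 1\<close>) of the Kaneko--Yamamoto series of two nonempty indices.\<close>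

definition ky_term :: "nat list \<Rightarrow> nat list \<Rightarrow> nat \<Rightarrow> real" where
  "ky_term ks ls n = mhs (n - 1) (tl ks) * mhs_star n (tl ls) / real n ^ (hd ks + hd ls)"

text \<open>The series starts at \<open>n = 1\<close>, hence the shift by \<open>Suc\<close>.\<close>

definition ky_mzv :: "nat list \<Rightarrow> nat list \<Rightarrow> real" where
  "ky_mzv ks ls = (\<Sum>n. ky_term ks ls (Suc n))"

text \<open>The Riemann zeta value at an integer \<open>k \<ge> 2\<close>.\<close>

definition zeta_value :: "nat \<Rightarrow> real" where
  "zeta_value k = (\<Sum>n. 1 / real (Suc n) ^ k)"

text \<open>
  The ring \<open>\<rat>[S]\<close> of polynomial expressions with rational coefficients in the elements of
  \<open>S\<close>, that is, the \<open>\<rat>\<close>-subalgebra of the reals generated by \<open>S\<close>.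
\<close>

inductive_set rat_adjoin :: "real set \<Rightarrow> real set" for S :: "real set" where
  rat: "q \<in> \<rat> \<Longrightarrow> q \<in> rat_adjoin S"
| gen: "x \<in> S \<Longrightarrow> x \<in> rat_adjoin S"
| add: "x \<in> rat_adjoin S \<Longrightarrow> y \<in> rat_adjoin S \<Longrightarrow> x + y \<in> rat_adjoin S"
| mult: "x \<in> rat_adjoin S \<Longrightarrow> y \<in> rat_adjoin S \<Longrightarrow> x * y \<in> rat_adjoin S"

text \<open>The sequence \<open>{ks}\<^sub>d\<close>: the block \<open>ks\<close> repeated \<open>d\<close> times.\<close>

definition rep :: "nat \<Rightarrow> nat list \<Rightarrow> nat list" where
  "rep d ks = concat (replicate d ks)"

end

(*
  The Newton series sum_n (-1)^(n-1) binom(s,n) mhs_star n ls / n interpolates the numbers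
  mhs_star N (m+1,...,m+1) (Hoffman duality) to real s > -1, so at s = -x it equals the complete
  homogeneous symmetric function of degree p of the differences between the families
  1/j^(m+1) and 1/(j-x)^(m+1), j >= 1. By Newton's identities that is a polynomial in
  sum_j (1/j^(i(m+1)) - 1/(j-x)^(i(m+1))), whose Taylor coefficients in x are rational multiples of
  zeta values. On the other hand (-1)^n binom(-x,n) is the generating function in x of
  mhs (n-1) (1,...,1) / n, so the Taylor coefficients of the Newton series are, up to sign, the
  Kaneko--Yamamoto values in question.
*)
theory Submission
  imports Defs "HOL-Analysis.Analysis"
begin

unbundle fps_syntax
unbundle no vec_syntax

section \<open>Recursions for multiple harmonic sums\<close>

text \<open>A nonnegative difference table is a table of Hausdorff moments: \<open>a j i\<close> is
  the integral of t^i (1-t)^j for a positive measure on [0,1]. As the sum of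
  \<open>weight x i * t^i\<close> is (1-t)^(-x), the weighted sum of row \<open>j\<close> is the
  integral of (1-t)^s with s = j - x, and \<open>newton x a j\<close> is that of (1 - (1-t)^s)/t.
  The tables do the work of these integrals; limits then rest on nonnegativity, whence the range 0
  \<le> x < 1. The functional equation linking s and s + 1 fixes the generating function only up to
  a factor of period 1. What pins it down is that its values at j - x and at j approach each other
  as j grows. With a_k = 1/(k+1)^(m+1) and b_k = 1/(k+1-x)^(m+1), the series at s = -x is therefore
  the limit of the finite products of (1 - b_k X)/(1 - a_k X), and Newton's identities pass to the
  limit from these. The exponent m + 1 is at least 2, so the sum of the b_k is finite and controls
  the products.\<close>

lemma sum_descending_lists:
  fixes f :: "nat \<Rightarrow> nat \<Rightarrow> real"
  assumes R: "\<And>a b. 1 \<le> a \<Longrightarrow> 1 \<le> b \<Longrightarrow> R a b \<longleftrightarrow> b \<le> h a" and h: "\<And>a. a \<ge> 1 \<Longrightarrow> h a \<le> a"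
  shows "(\<Sum>ns | length ns = Suc l \<and> set ns \<subseteq> {1..n} \<and> sorted_wrt R ns. \<Prod>j<Suc l. f j (ns ! j))
    = (\<Sum>a = 1..n. f 0 a * (\<Sum>ns | length ns = l \<and> set ns \<subseteq> {1..h a} \<and> sorted_wrt R ns. \<Prod>j<l. f (Suc j) (ns ! j)))"
proof -
  define B where "B = (\<lambda>a. {ns. length ns = l \<and> set ns \<subseteq> {1..h a} \<and> sorted_wrt R ns})"
  have fin: "finite (B a)" for a
    unfolding B_def by (rule finite_subset[OF _ finite_lists_length_eq[of "{1..h a}" l]]) auto
  have "(\<Sum>a = 1..n. f 0 a * (\<Sum>ns\<in>B a. \<Prod>j<l. f (Suc j) (ns ! j)))
      = (\<Sum>(a, ns)\<in>Sigma {1..n} B. f 0 a * (\<Prod>j<l. f (Suc j) (ns ! j)))"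
    by (simp add: sum_distrib_left sum.Sigma fin)
  also have "\<dots> = (\<Sum>ns | length ns = Suc l \<and> set ns \<subseteq> {1..n} \<and> sorted_wrt R ns. \<Prod>j<Suc l. f j (ns ! j))"
  proof (rule sum.reindex_bij_witness[of _ "\<lambda>ns. (hd ns, tl ns)" "\<lambda>(a, ns). a # ns"])
    fix ns assume ns: "ns \<in> {ns. length ns = Suc l \<and> set ns \<subseteq> {1..n} \<and> sorted_wrt R ns}"
    then obtain a ms where [simp]: "ns = a # ms" by (cases ns) auto
    show "(hd ns, tl ns) \<in> Sigma {1..n} B"
      using ns by (auto simp: B_def R subset_iff)
    show "(case (hd ns, tl ns) of (a, ns) \<Rightarrow> a # ns) = ns" by simp
  next
    fix u assume u: "u \<in> Sigma {1..n} B"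
    obtain a ms where [simp]: "u = (a, ms)" by (cases u)
    \<comment> \<open>\<open>h a\<close> is the largest entry allowed after \<open>a\<close>:
      \<open>a - 1\<close> for \<open>mhs\<close> and \<open>a\<close> for
      \<open>mhs_star\<close>.\<close>
    have "h a \<le> n" using u h[of a] by auto
    then show "(case u of (a, ns) \<Rightarrow> a # ns) \<in> {ns. length ns = Suc l \<and> set ns \<subseteq> {1..n} \<and> sorted_wrt R ns}"
      using u by (fastforce simp: B_def R subset_iff)
  qed (auto simp: prod.lessThan_Suc_shift simp del: prod.lessThan_Suc)
  finally show ?thesis by (simp add: B_def)
qed

lemma mhs_Nil [simp]: "mhs n [] = 1" and mhs_star_Nil [simp]: "mhs_star n [] = 1"
proof -
  have "{ns. length ns = 0 \<and> set ns \<subseteq> {1..n} \<and> sorted_wrt R ns} = {[]}" for R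
    by auto
  then show "mhs n [] = 1" "mhs_star n [] = 1" by (simp_all add: mhs_def mhs_star_def)
qed

lemma mhs_Cons: "mhs n (k # ks) = (\<Sum>a = 1..n. mhs (a - 1) ks / real a ^ k)"
  unfolding mhs_def list.size(4) add_Suc_right add_0_right
  by (subst sum_descending_lists[where h="\<lambda>a. a - 1" and f="\<lambda>j a. 1 / real a ^ ((k # ks) ! j)"]) auto

lemma mhs_star_Cons: "mhs_star n (k # ks) = (\<Sum>a = 1..n. mhs_star a ks / real a ^ k)"
  unfolding mhs_star_def list.size(4) add_Suc_right add_0_right
  by (subst sum_descending_lists[where h="\<lambda>a. a" and f="\<lambda>j a. 1 / real a ^ ((k # ks) ! j)"]) auto

lemma rep_simps [simp]: "rep 0 ks = []" "rep (Suc d) ks = ks @ rep d ks"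
  by (simp_all add: rep_def)

section \<open>Difference tables and Newton series\<close>

text \<open>\<open>weight x n\<close> is \<open>(-1)\<^sup>n\<close> times the binomial coefficient of \<open>-x\<close> over \<open>n\<close>.\<close>

definition weight :: "real \<Rightarrow> nat \<Rightarrow> real" where
  "weight x n = pochhammer x n / fact n"

lemma weight_0 [simp]: "weight x 0 = 1"
  by (simp add: weight_def)

lemma weight_Suc: "(real n + 1) * weight x (Suc n) = (real n + x) * weight x n"
  by (simp add: weight_def pochhammer_Suc divide_simps add.commute del: of_nat_Suc)

lemma weight_zero_Suc [simp]: "weight 0 (Suc n) = 0"
  by (simp add: weight_def pochhammer_0_left)

lemma weight_nonneg: "0 \<le> x \<Longrightarrow> 0 \<le> weight x n"
  by (cases "x = 0") (auto simp: weight_def pochhammer_0_left intro!: divide_nonneg_pos pochhammer_nonneg)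

lemma weight_Suc_le:
  assumes "0 \<le> x" "x < 1"
  shows "weight x (Suc n) \<le> weight x n"
proof -
  have "(real n + 1) * weight x (Suc n) \<le> (real n + 1) * weight x n"
    unfolding weight_Suc using assms weight_nonneg[of x n] by (intro mult_right_mono) auto
  then show ?thesis by (simp add: mult_le_cancel_left)
qed

text \<open>Nonnegative difference tables: row \<open>j\<close> consists of the \<open>j\<close>-th iterated differences
  (with alternating sign) of row \<open>0\<close>. Position \<open>i\<close> holds the term of index \<open>i + 1\<close> of the
  sequence.\<close>

definition dtable :: "(nat \<Rightarrow> nat \<Rightarrow> real) \<Rightarrow> bool" where
  "dtable a \<longleftrightarrow> (\<forall>j i. 0 \<le> a j i \<and> a (Suc j) i + a j (Suc i) = a j i)"

lemma dtableD:
  assumes "dtable a"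
  shows "0 \<le> a j i" "a (Suc j) i = a j i - a j (Suc i)" "a (Suc j) i \<le> a j i"
proof -
  from assms have "0 \<le> a j i" "0 \<le> a j (Suc i)" "a (Suc j) i + a j (Suc i) = a j i"
    unfolding dtable_def by blast+
  then show "0 \<le> a j i" "a (Suc j) i = a j i - a j (Suc i)" "a (Suc j) i \<le> a j i" by simp_all
qed

lemma dtable_le_0: "dtable a \<Longrightarrow> a j i \<le> a 0 i"
  by (induction j) (auto intro: order_trans dtableD(3))

lemma dtable_transpose: "dtable a \<Longrightarrow> dtable (\<lambda>j i. a i j)"
  by (auto simp: dtable_def add.commute)

text \<open>On row \<open>0\<close>, \<open>cesaro\<close> takes Cesaro means and \<open>cesaro_dual\<close> divides the \<open>n\<close>-th term
  by \<open>n\<close>; the recursions are what these operations become on whole difference tables, and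
  transposition exchanges them.\<close>

fun cesaro :: "(nat \<Rightarrow> nat \<Rightarrow> real) \<Rightarrow> nat \<Rightarrow> nat \<Rightarrow> real" where
  "cesaro a j 0 = a j 0 / (real j + 1)"
| "cesaro a j (Suc i) = ((real i + 1) * cesaro a j i + a j (Suc i)) / (real j + real i + 2)"

definition cesaro_dual :: "(nat \<Rightarrow> nat \<Rightarrow> real) \<Rightarrow> nat \<Rightarrow> nat \<Rightarrow> real" where
  "cesaro_dual a j i = cesaro (\<lambda>j i. a i j) i j"

lemma cesaro_Suc: "(real j + real i + 2) * cesaro a j (Suc i) = (real i + 1) * cesaro a j i + a j (Suc i)"
  by simp

lemma cesaro_dual_0: "cesaro_dual a 0 i = a 0 i / (real i + 1)"
  by (simp add: cesaro_dual_def)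

lemma cesaro_dual_Suc:
  "(real j + real i + 2) * cesaro_dual a (Suc j) i = (real j + 1) * cesaro_dual a j i + a (Suc j) i"
  using cesaro_Suc[of i j "\<lambda>j i. a i j"] by (simp add: cesaro_dual_def add.commute)

text \<open>The entries \<open>(Suc j, i)\<close> and \<open>(j, Suc i)\<close> lie on one
  antidiagonal, so their recursions share a denominator and can be added.\<close>

lemma dtable_cesaro:
  assumes a: "dtable a"
  shows "dtable (cesaro a)"
proof -
  have "0 \<le> cesaro a j i" for j i
    by (induction i) (use dtableD(1)[OF a] in auto)
  moreover have "cesaro a (Suc j) i + cesaro a j (Suc i) = cesaro a j i" for j i
  proof (induction i)
    case 0
    have "a (Suc j) 0 + a j (Suc 0) = a j 0" using a by (simp add: dtable_def)
    then have e: "a j (Suc 0) = a j 0 - a (Suc j) 0" by simp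
    show ?case unfolding cesaro.simps e by (simp add: divide_simps) (simp add: algebra_simps)
  next
    case (Suc i)
    let ?b = "cesaro a"
    have e: "a (Suc j) (Suc i) + a j (Suc (Suc i)) = a j (Suc i)" using a by (simp add: dtable_def)
    have "(real j + real i + 3) * (?b (Suc j) (Suc i) + ?b j (Suc (Suc i)))
        = (real i + 1) * (?b (Suc j) i + ?b j (Suc i)) + ?b j (Suc i)
          + (a (Suc j) (Suc i) + a j (Suc (Suc i)))"
      using cesaro_Suc[of "Suc j" i a] cesaro_Suc[of j "Suc i" a]
      by (simp add: algebra_simps del: cesaro.simps)
    also have "\<dots> = (real i + 1) * ?b j i + a j (Suc i) + ?b j (Suc i)"
      unfolding e Suc.IH by simp
    also have "\<dots> = (real j + real i + 3) * ?b j (Suc i)"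
      using cesaro_Suc[of j i a] by (simp add: algebra_simps del: cesaro.simps)
    finally show ?case using mult_cancel_left[of "real j + real i + 3"] by (simp del: cesaro.simps)
  qed
  ultimately show ?thesis unfolding dtable_def by blast
qed

lemma dtable_cesaro_dual: "dtable a \<Longrightarrow> dtable (cesaro_dual a)"
  unfolding cesaro_dual_def[abs_def]
  by (intro dtable_transpose[of "cesaro (\<lambda>j i. a i j)"] dtable_cesaro dtable_transpose[of a])

text \<open>A positive limit would make \<open>u i\<close> exceed a multiple of 1/(i + x), whose
  series diverges. This disposes of the boundary term in \<open>cesaro_partial\<close>.\<close>

lemma tendsto_0_if_summable:
  fixes u :: "nat \<Rightarrow> real"
  assumes "summable u" "\<And>i. 0 \<le> u i" "0 \<le> x" "(\<lambda>i. (real i + x) * u i) \<longlonglongrightarrow> l"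
  shows "l = 0"
proof (rule ccontr)
  assume "l \<noteq> 0"
  moreover have "0 \<le> l"
    using assms by (intro LIMSEQ_le_const[OF assms(4)]) auto
  ultimately have "0 < l" by simp
  then have "\<forall>\<^sub>F i in sequentially. l / 2 < (real i + x) * u i"
    using assms(4) by (intro order_tendstoD) auto
  then have "\<forall>\<^sub>F i in sequentially. norm (1 / (real i + x)) \<le> 2 / l * u i"
    using eventually_gt_at_top[of 0]
    by eventually_elim (use \<open>0 < l\<close> \<open>0 \<le> x\<close> in \<open>simp add: field_simps\<close>)
  then have s: "summable (\<lambda>i. 1 / (real i + x))"
    by (rule summable_comparison_test_ev[OF _ summable_mult[OF assms(1)]])
  have "\<forall>\<^sub>F i in sequentially. norm (1 / real i) \<le> (1 + x) * (1 / (real i + x))"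
    using eventually_gt_at_top[of 0]
  proof eventually_elim
    case (elim i)
    have "x \<le> x * real i" using elim \<open>0 \<le> x\<close> mult_left_mono[of 1 "real i" x] by simp
    then show ?case using elim \<open>0 \<le> x\<close> by (simp add: field_simps)
  qed
  then have "summable (\<lambda>i. 1 / real i)"
    by (rule summable_comparison_test_ev[OF _ summable_mult[OF s]])
  then show False
    using not_summable_harmonic[where 'a=real] by (simp add: inverse_eq_divide)
qed

text \<open>The Newton series of row \<open>0\<close>, with terms \<open>(-1)\<^sup>n\<^sup>-\<^sup>1 binom(s, n) a\<^sub>n\<close>, at
  \<open>s = j - x\<close>: its value at \<open>-x\<close> plus the \<open>j\<close> increments from there.\<close>

definition newton :: "real \<Rightarrow> (nat \<Rightarrow> nat \<Rightarrow> real) \<Rightarrow> nat \<Rightarrow> real" where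
  "newton x a j = (\<Sum>k<j. \<Sum>i. weight x i * a k i) - (\<Sum>i. weight x (Suc i) * a 0 i)"

context
  fixes x :: real
  assumes x: "0 \<le> x" "x < 1"
begin


lemma summable_weight_row:
  assumes "dtable a" "summable (\<lambda>i. weight x i * a 0 i)"
  shows "summable (\<lambda>i. weight x i * a j i)"
  by (rule summable_comparison_test'[OF assms(2), of 0])
     (use assms x in \<open>auto simp: abs_mult weight_nonneg dtableD(1) intro!: mult_left_mono dtable_le_0[OF assms(1)]\<close>)

text \<open>Summation by parts: the recursion writes \<open>a j i\<close> through neighbouring
  entries of \<open>cesaro a\<close>, and \<open>weight_Suc\<close> collapses everything except one
  boundary term.\<close>

lemma cesaro_partial:
  "(real j + 1 - x) * (\<Sum>i<Suc n. weight x i * cesaro a j i) + (real n + x) * (weight x n * cesaro a j n)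
    = (\<Sum>i<Suc n. weight x i * a j i)"
proof (induction n)
  case 0
  have "0 < real j + 1" by simp
  then show ?case by (simp add: divide_simps) (simp add: algebra_simps)
next
  case (Suc n)
  have 1: "(real n + x) * weight x n = (real n + 1) * weight x (Suc n)"
    by (simp add: weight_Suc)
  have 2: "a j (Suc n) = (real j + real n + 2) * cesaro a j (Suc n) - (real n + 1) * cesaro a j n"
    by (simp only: cesaro_Suc)
  have 3: "(real n + x) * (weight x n * cesaro a j n) = (real n + 1) * weight x (Suc n) * cesaro a j n"
    unfolding mult.assoc[symmetric] 1 ..
  show ?case
    unfolding sum.lessThan_Suc[of _ "Suc n"] Suc.IH[symmetric] 2 3
    by (simp add: algebra_simps del: cesaro.simps sum.lessThan_Suc)
qed

text \<open>The boundary term in \<open>cesaro_partial\<close> is nonnegative, which bounds the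
  partial sums; it then converges, and being \<open>n + x\<close> times the term of a convergent
  series, it tends to 0.\<close>

lemma weighted_cesaro:
  assumes a: "dtable a" and s: "summable (\<lambda>i. weight x i * a j i)"
  shows "summable (\<lambda>i. weight x i * cesaro a j i)"
    and "(real j + 1 - x) * (\<Sum>i. weight x i * cesaro a j i) = (\<Sum>i. weight x i * a j i)"
proof -
  let ?u = "\<lambda>i. weight x i * cesaro a j i"
  have u: "0 \<le> ?u i" for i
    using x dtableD(1)[OF dtable_cesaro[OF a]] by (simp add: weight_nonneg)
  have pos: "0 < real j + 1 - x" using x by simp
  show su: "summable ?u"
  proof (rule bounded_imp_summable[OF u])
    fix n
    have "(\<Sum>i<Suc n. ?u i) * (real j + 1 - x) \<le> (\<Sum>i<Suc n. weight x i * a j i)"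
      using cesaro_partial[where j=j and n=n and a=a, symmetric] x u[of n] by (simp add: mult.commute del: sum.lessThan_Suc)
    also have "\<dots> \<le> (\<Sum>i. weight x i * a j i)"
      using x dtableD(1)[OF a] by (intro sum_le_suminf[OF s]) (auto simp: weight_nonneg)
    finally show "sum ?u {..n} \<le> (\<Sum>i. weight x i * a j i) / (real j + 1 - x)"
      using pos by (simp add: field_simps lessThan_Suc_atMost)
  qed
  have lim: "(\<lambda>n. \<Sum>i<Suc n. f i) \<longlonglongrightarrow> suminf f" if "summable f" for f :: "nat \<Rightarrow> real"
    using summable_LIMSEQ[OF that] by (rule LIMSEQ_Suc)
  have "(\<lambda>n. (\<Sum>i<Suc n. weight x i * a j i) - (real j + 1 - x) * (\<Sum>i<Suc n. ?u i))
      \<longlonglongrightarrow> (\<Sum>i. weight x i * a j i) - (real j + 1 - x) * (\<Sum>i. ?u i)"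
    by (intro tendsto_diff tendsto_mult_left lim s su)
  then have "(\<lambda>n. (real n + x) * ?u n) \<longlonglongrightarrow> (\<Sum>i. weight x i * a j i) - (real j + 1 - x) * (\<Sum>i. ?u i)"
    unfolding cesaro_partial[where a=a and j=j, symmetric] by simp
  then show "(real j + 1 - x) * suminf ?u = (\<Sum>i. weight x i * a j i)"
    using tendsto_0_if_summable[OF su u x(1)] by force
qed

lemma summable_weight_Suc:
  assumes "dtable a" "summable (\<lambda>i. weight x i * a 0 i)"
  shows "summable (\<lambda>i. weight x (Suc i) * a j i)"
  by (rule summable_comparison_test'[OF summable_weight_row[OF assms, of j], of 0])
     (use assms x in \<open>auto simp: abs_mult weight_nonneg dtableD(1)[OF assms(1)] intro!: mult_right_mono weight_Suc_le\<close>)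

text \<open>With s = j - x, this brings the Newton series at s + 1 into the functional equation.
  Only row 0 of \<open>cesaro_dual a\<close> is explicit, so the other rows are reached by
  induction.\<close>

lemma weighted_cesaro_dual:
  assumes a: "dtable a" and s: "summable (\<lambda>i. weight x i * a 0 i)"
  shows "summable (\<lambda>i. weight x i * cesaro_dual a j i)"
    and "(real j + 1 - x) * (\<Sum>i. weight x i * cesaro_dual a j i) = newton x a (Suc j)"
proof -
  let ?b = "cesaro_dual a"
  have b: "dtable ?b" using a by (rule dtable_cesaro_dual)
  have "summable (\<lambda>i. weight x i * ?b 0 i)"
    by (rule summable_comparison_test'[OF s, of 0])
       (use a x dtableD(1)[OF a] in \<open>auto simp: abs_mult weight_nonneg dtableD(1) cesaro_dual_0 field_simps
          intro!: mult_left_mono\<close>)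
  then have sb: "summable (\<lambda>i. weight x i * ?b j i)" for j
    by (rule summable_weight_row[OF b])
  show "summable (\<lambda>i. weight x i * ?b j i)" by (rule sb)
  note sa = summable_weight_row[OF a s]
  let ?W = "\<lambda>j. \<Sum>i. weight x i * ?b j i"
  have base: "(1 - x) * ?W 0 = newton x a 1"
  proof -
    have "(1 - x) * (weight x i * ?b 0 i) = weight x i * a 0 i - weight x (Suc i) * a 0 i" for i
    proof -
      have "weight x (Suc i) = (real i + x) * weight x i / (real i + 1)"
        using weight_Suc[of i x] by (simp add: field_simps)
      then show ?thesis by (simp add: cesaro_dual_0 divide_simps) (simp add: algebra_simps)
    qed
    then have "(1 - x) * ?W 0 = (\<Sum>i. weight x i * a 0 i - weight x (Suc i) * a 0 i)"
      by (subst suminf_mult[symmetric, OF sb]) simp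
    also have "\<dots> = newton x a 1"
      unfolding newton_def by (subst suminf_diff[symmetric, OF s summable_weight_Suc[OF a s]]) simp
    finally show ?thesis .
  qed
  have step: "(real j + 2 - x) * ?W (Suc j) = (real j + 1 - x) * ?W j + (\<Sum>i. weight x i * a (Suc j) i)" for j
  proof -
    \<comment> \<open>The differences of \<open>?d\<close> are exactly the terms of the claim;
      \<open>?d\<close> tends to 0 because \<open>(i + 1) * ?b 0 i = a 0 i\<close>.\<close>
    let ?d = "\<lambda>i. real i * weight x i * ?b j i"
    have "?d \<longlonglongrightarrow> 0"
    proof (rule tendsto_sandwich[OF _ _ tendsto_const summable_LIMSEQ_zero[OF s]])
      show "\<forall>\<^sub>F i in sequentially. 0 \<le> ?d i"
        using x dtableD(1)[OF b] by (simp add: weight_nonneg)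
      have "?d i \<le> weight x i * a 0 i" for i
      proof -
        have "real i * ?b j i \<le> (real i + 1) * ?b 0 i"
          using dtable_le_0[OF b, of j i] dtableD(1)[OF b] by (intro mult_mono) auto
        also have "\<dots> = a 0 i" by (simp add: cesaro_dual_0)
        finally show ?thesis
          using mult_left_mono[of "real i * ?b j i" "a 0 i" "weight x i"] x
          by (simp add: weight_nonneg algebra_simps)
      qed
      then show "\<forall>\<^sub>F i in sequentially. ?d i \<le> weight x i * a 0 i" by simp
    qed
    then have "(\<lambda>i. ?d i - ?d (Suc i)) sums (?d 0 - 0)" by (rule telescope_sums')
    then have d: "(\<lambda>i. ?d i - ?d (Suc i)) sums 0" by simp
    have "?d i - ?d (Suc i) = weight x i * a (Suc j) i + (real j + 1 - x) * (weight x i * ?b j i)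
        - (real j + 2 - x) * (weight x i * ?b (Suc j) i)" for i
    proof -
      have 1: "a (Suc j) i = (real j + real i + 2) * ?b (Suc j) i - (real j + 1) * ?b j i"
        by (simp add: cesaro_dual_Suc)
      have 2: "?d (Suc i) = (real i + x) * weight x i * ?b j (Suc i)"
        using weight_Suc[of i x] by (simp add: algebra_simps)
      have 3: "?b j (Suc i) = ?b j i - ?b (Suc j) i" using dtableD(2)[OF b, of j i] by simp
      show ?thesis unfolding 1 2 unfolding 3 by (simp add: algebra_simps)
    qed
    then have "(\<lambda>i. ?d i - ?d (Suc i)) sums ((\<Sum>i. weight x i * a (Suc j) i) + (real j + 1 - x) * ?W j
        - (real j + 2 - x) * ?W (Suc j))"
      by (simp only:) (intro sums_diff sums_add sums_mult summable_sums sa sb)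
    from sums_unique2[OF d this] show ?thesis by simp
  qed
  show "(real j + 1 - x) * ?W j = newton x a (Suc j)"
  proof (induction j)
    case 0
    show ?case using base by simp
  next
    case (Suc j)
    then show ?case using step[of j] by (simp add: newton_def algebra_simps)
  qed
qed

text \<open>The expansion recentred at the integer \<open>j\<close>: the finite sum is the value at
  \<open>j\<close>, and the series is the correction for moving to \<open>j - x\<close>.\<close>

lemma newton_eq:
  assumes a: "dtable a" and s: "summable (\<lambda>i. weight x i * a 0 i)"
  shows "newton x a j = (\<Sum>k<j. a k 0) - (\<Sum>i. weight x (Suc i) * a j i)"
proof (induction j)
  case 0
  then show ?case by (simp add: newton_def)
next
  case (Suc j)
  note sa = summable_weight_row[OF a s] and ss = summable_weight_Suc[OF a s]
  have "(\<Sum>i. weight x (Suc i) * a (Suc j) i) = (\<Sum>i. weight x (Suc i) * a j i) - (\<Sum>i. weight x (Suc i) * a j (Suc i))"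
    unfolding dtableD(2)[OF a] right_diff_distrib
    using sa[of j] by (intro suminf_diff[symmetric] ss) (simp add: summable_Suc_iff[where f="\<lambda>i. weight x i * a j i"])
  also have "(\<Sum>i. weight x (Suc i) * a j (Suc i)) = (\<Sum>i. weight x i * a j i) - a j 0"
    using suminf_split_head[OF sa[of j]] by simp
  finally show ?case using Suc.IH by (simp add: newton_def)
qed

end

section \<open>Newton's identities and power series\<close>

text \<open>Logarithmic differentiation: \<open>D j\<close> is the product of (1 - b_k X)/(1 - a_k
  X), so X D'/D is the generating function \<open>Q j\<close> of the differences of power
  sums.\<close>

lemma fps_prod_newton_identity:
  fixes D :: "nat \<Rightarrow> real fps" and a b :: "nat \<Rightarrow> real"
  assumes D0: "D 0 = 1"
    and step: "\<And>j. D (Suc j) * (1 - fps_const (a j) * fps_X) = D j * (1 - fps_const (b j) * fps_X)"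
  shows "real p * D j $ p = (\<Sum>i = 1..p. (\<Sum>k<j. a k ^ i - b k ^ i) * D j $ (p - i))"
proof -
  define Q where "Q j = Abs_fps (\<lambda>i. \<Sum>k<j. a k ^ i - b k ^ i)" for j
  have geo: "(1 - fps_const c * fps_X) * Abs_fps (\<lambda>i. c ^ i) = 1" for c :: real
  proof (rule fps_ext)
    fix n show "((1 - fps_const c * fps_X) * Abs_fps (\<lambda>i. c ^ i)) $ n = 1 $ n"
      by (cases n) (simp_all add: left_diff_distrib mult.assoc)
  qed
  have Q_Suc: "Q (Suc j) = Q j + Abs_fps (\<lambda>i. a j ^ i) - Abs_fps (\<lambda>i. b j ^ i)" for j
    by (rule fps_ext) (simp add: Q_def)
  have "fps_X * fps_deriv (D j) = D j * Q j"
  proof (induction j)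
    case 0
    have "Q 0 = 0" by (rule fps_ext) (simp add: Q_def)
    then show ?case by (simp add: D0)
  next
    case (Suc j)
    let ?A = "1 - fps_const (a j) * fps_X" and ?B = "1 - fps_const (b j) * fps_X"
    let ?ga = "Abs_fps (\<lambda>i. a j ^ i)" and ?gb = "Abs_fps (\<lambda>i. b j ^ i)"
    have nz: "?A \<noteq> 0" using geo[of "a j"] by auto
    have "fps_deriv (D (Suc j) * ?A) = fps_deriv (D j * ?B)" by (simp only: step)
    then have d: "fps_deriv (D (Suc j)) * ?A - D (Suc j) * fps_const (a j)
        = fps_deriv (D j) * ?B - D j * fps_const (b j)"
      by (simp flip: fps_const_neg)
    have "fps_X * fps_deriv (D (Suc j)) * ?A
        = fps_X * (fps_deriv (D (Suc j)) * ?A - D (Suc j) * fps_const (a j)) + fps_X * fps_const (a j) * D (Suc j)"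
      by (simp add: algebra_simps)
    also have "\<dots> = (fps_X * fps_deriv (D j)) * ?B - fps_X * fps_const (b j) * D j + fps_X * fps_const (a j) * D (Suc j)"
      unfolding d by (simp add: algebra_simps)
    also have "\<dots> = D j * ?B * Q j - fps_X * fps_const (b j) * D j * (?B * ?gb) + fps_X * fps_const (a j) * D (Suc j) * (?A * ?ga)"
      unfolding Suc.IH geo by (simp add: mult_ac)
    also have "\<dots> = D j * ?B * (Q j - fps_X * fps_const (b j) * ?gb) + D (Suc j) * ?A * (fps_X * fps_const (a j) * ?ga)"
      by (simp only: algebra_simps)
    also have "\<dots> = D (Suc j) * ?A * (Q j + fps_X * fps_const (a j) * ?ga - fps_X * fps_const (b j) * ?gb)"
      unfolding step[symmetric] by (simp only: algebra_simps)
    also have "fps_X * fps_const (a j) * ?ga = ?ga - 1"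
      using geo[of "a j"] by (simp add: algebra_simps)
    also have "fps_X * fps_const (b j) * ?gb = ?gb - 1"
      using geo[of "b j"] by (simp add: algebra_simps)
    finally have "fps_X * fps_deriv (D (Suc j)) * ?A = (D (Suc j) * Q (Suc j)) * ?A"
      by (simp add: Q_Suc algebra_simps)
    with nz show ?case by simp
  qed
  then have "(fps_X * fps_deriv (D j)) $ p = (Q j * D j) $ p" by (simp add: mult.commute)
  moreover have "(fps_X * fps_deriv (D j)) $ p = real p * D j $ p"
    by (cases p) auto
  \<comment> \<open>The sum may start at 1 because the constant coefficient of \<open>Q j\<close> is
    0.\<close>
  moreover have "(Q j * D j) $ p = (\<Sum>i = 1..p. (\<Sum>k<j. a k ^ i - b k ^ i) * D j $ (p - i))"
    by (simp add: fps_mult_nth Q_def sum.atLeast_Suc_atMost)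
  ultimately show ?thesis by simp
qed

text \<open>\<open>F\<close> has no known starting value, but \<open>E\<close> has one and the two
  agree at infinity. Multiplication by \<open>P j\<close> carries this back to index 0:
  \<open>P j * E j\<close> tends to \<open>P j * F j = F 0\<close>.\<close>

lemma newton_identity_limit:
  fixes F E :: "nat \<Rightarrow> real fps" and a b :: "nat \<Rightarrow> real"
  assumes F: "\<And>j. F (Suc j) * (1 - fps_const (b j) * fps_X) = F j"
    and E: "\<And>j. E (Suc j) * (1 - fps_const (a j) * fps_X) = E j" and E0: "E 0 = 1"
    and lim: "\<And>p. (\<lambda>j. F j $ p - E j $ p) \<longlonglongrightarrow> 0"
    and b: "summable b" "\<And>j. 0 \<le> b j"
    and sum_ab: "\<And>i. 1 \<le> i \<Longrightarrow> (\<lambda>j. a j ^ i - b j ^ i) sums Q i"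
  shows "real p * F 0 $ p = (\<Sum>i = 1..p. Q i * F 0 $ (p - i))"
proof -
  define P where "P j = (\<Prod>k<j. 1 - fps_const (b k) * fps_X)" for j
  have PF: "P j * F j = F 0" for j
  proof (induction j)
    case 0
    show ?case by (simp add: P_def)
  next
    case (Suc j)
    have "P (Suc j) * F (Suc j) = P j * (F (Suc j) * (1 - fps_const (b j) * fps_X))"
      by (simp add: P_def mult_ac)
    then show ?case by (simp only: F Suc.IH)
  qed
  define D where "D j = P j * E j" for j
  have D_Suc: "D (Suc j) * (1 - fps_const (a j) * fps_X) = D j * (1 - fps_const (b j) * fps_X)" for j
  proof -
    have "D (Suc j) * (1 - fps_const (a j) * fps_X) = P (Suc j) * (E (Suc j) * (1 - fps_const (a j) * fps_X))"
      by (simp add: D_def mult_ac)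
    also have "\<dots> = D j * (1 - fps_const (b j) * fps_X)"
      unfolding E by (simp add: D_def P_def mult_ac)
    finally show ?thesis .
  qed
  have D0: "D 0 = 1" by (simp add: D_def P_def E0)
  note newton = fps_prod_newton_identity[of D, OF D0 D_Suc]
  \<comment> \<open>Uniformity in \<open>j\<close> keeps the product of \<open>P j\<close> with a
    null sequence null.\<close>
  have bound: "\<bar>P j $ p\<bar> \<le> suminf b ^ p" for j p
  proof (cases p)
    case 0
    have "P j $ 0 = 1" by (induction j) (auto simp: P_def)
    then show ?thesis using 0 by simp
  next
    case (Suc q)
    \<comment> \<open>The partial sum as a factor lets the induction on \<open>j\<close> close: a
      new factor of \<open>P\<close> adds at most \<open>b j\<close> times the bound one degree
      lower.\<close>
    have "\<bar>P j $ Suc q\<bar> \<le> (\<Sum>k<j. b k) * suminf b ^ q" for q j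
    proof (induction q arbitrary: j)
      case 0
      have 1: "P j $ 0 = 1" for j by (induction j) (auto simp: P_def)
      show ?case
      proof (induction j)
        case (Suc j)
        have "P (Suc j) $ Suc 0 = P j $ Suc 0 - b j"
          using 1[of j] by (simp add: P_def algebra_simps)
        then show ?case using Suc.IH b(2)[of j] by simp
      qed (simp add: P_def)
    next
      case (Suc q)
      have le: "\<bar>P j $ Suc q\<bar> \<le> suminf b ^ Suc q" for j
        using Suc.IH[of j] mult_right_mono[OF sum_le_suminf[OF b(1), of "{..<j}"], of "suminf b ^ q"]
          suminf_nonneg[OF b] b(2) by auto
      show ?case
      proof (induction j)
        case (Suc j)
        have "P (Suc j) $ Suc (Suc q) = P j $ Suc (Suc q) - b j * P j $ Suc q"
          by (simp add: P_def algebra_simps)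
        moreover have "\<bar>b j * P j $ Suc q\<bar> \<le> b j * suminf b ^ Suc q"
          using le[of j] b(2)[of j] by (simp add: abs_mult mult_left_mono)
        ultimately show ?case using Suc.IH by (simp add: algebra_simps)
      qed (simp add: P_def)
    qed
    from order_trans[OF this[of j q] mult_right_mono[OF sum_le_suminf[OF b(1), of "{..<j}"]]]
    show ?thesis using Suc suminf_nonneg[OF b] b(2) by auto
  qed
  have limD: "(\<lambda>j. D j $ p) \<longlonglongrightarrow> F 0 $ p" for p
  proof -
    have "(\<lambda>j. \<Sum>i\<le>p. P j $ i * (F j $ (p - i) - E j $ (p - i))) \<longlonglongrightarrow> (\<Sum>i\<le>p. 0)"
    proof (intro tendsto_sum)
      fix i
      show "(\<lambda>j. P j $ i * (F j $ (p - i) - E j $ (p - i))) \<longlonglongrightarrow> 0"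
        by (rule Lim_null_comparison[OF _ tendsto_mult_right_zero[OF tendsto_rabs_zero[OF lim[of "p - i"]], of "suminf b ^ i"]])
           (simp add: abs_mult bound mult_right_mono)
    qed
    moreover have "(\<Sum>i\<le>p. P j $ i * (F j $ (p - i) - E j $ (p - i))) = F 0 $ p - D j $ p" for j
    proof -
      have "F 0 - D j = P j * (F j - E j)" by (simp add: D_def PF right_diff_distrib)
      then have "F 0 $ p - D j $ p = (P j * (F j - E j)) $ p" by (metis fps_sub_nth)
      then show ?thesis by (simp add: fps_mult_nth atLeast0AtMost)
    qed
    ultimately have "(\<lambda>j. F 0 $ p - D j $ p) \<longlonglongrightarrow> 0" by simp
    from tendsto_diff[OF tendsto_const this, of "F 0 $ p"] show ?thesis by simp
  qed
  have "(\<lambda>j. real p * D j $ p) \<longlonglongrightarrow> real p * F 0 $ p"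
    by (intro tendsto_mult_left limD)
  moreover have "(\<lambda>j. real p * D j $ p) \<longlonglongrightarrow> (\<Sum>i = 1..p. Q i * F 0 $ (p - i))"
    unfolding newton by (intro tendsto_sum tendsto_mult limD sum_ab[unfolded sums_def]) auto
  ultimately show ?thesis by (rule LIMSEQ_unique)
qed

text \<open>The constant coefficient is the limit at 0 from the right; dividing by \<open>x\<close>
  brings the next one to the front. Positive \<open>x\<close> must suffice, as the Newton series is
  controlled only there.\<close>

lemma powser_unique:
  fixes a b :: "nat \<Rightarrow> real"
  assumes "\<And>x. 0 < x \<Longrightarrow> x < 1 \<Longrightarrow> (\<lambda>n. a n * x ^ n) sums f x"
    and "\<And>x. 0 < x \<Longrightarrow> x < 1 \<Longrightarrow> (\<lambda>n. b n * x ^ n) sums f x"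
  shows "a = b"
proof -
  have zero: "c 0 = 0" if c: "\<And>x. 0 < x \<Longrightarrow> x < 1 \<Longrightarrow> (\<lambda>n. c n * x ^ n) sums 0" for c :: "nat \<Rightarrow> real"
  proof -
    define g where "g x = (\<Sum>n. c n * x ^ n)" for x
    have "(g \<longlongrightarrow> c 0) (at 0)"
    proof (rule powser_limit_0)
      fix x :: real assume "norm x < 1"
      then obtain y where y: "norm x < y" "y < 1" using dense by blast
      then have "summable (\<lambda>n. c n * x ^ n)"
        by (intro powser_inside[OF sums_summable[OF c[of y]]]) auto
      then show "(\<lambda>n. c n * x ^ n) sums g x" unfolding g_def by (rule summable_sums)
    qed simp
    then have "(g \<longlongrightarrow> c 0) (at_right 0)" by (rule tendsto_mono[OF at_le, rotated]) simp
    moreover have "\<forall>\<^sub>F x in at_right 0. g x = 0"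
      unfolding eventually_at_right_field
      by (rule exI[of _ 1]) (use c in \<open>auto simp: g_def sums_iff\<close>)
    then have "(g \<longlongrightarrow> 0) (at_right 0)" by (rule tendsto_eventually)
    ultimately show "c 0 = 0" using tendsto_unique[of "at_right 0" g] by auto
  qed
  have zeros: "c n = 0" if "\<And>x. 0 < x \<Longrightarrow> x < 1 \<Longrightarrow> (\<lambda>n. c n * x ^ n) sums 0" for c :: "nat \<Rightarrow> real" and n
    using that
  proof (induction n arbitrary: c)
    case 0
    then show ?case by (rule zero)
  next
    case (Suc n)
    show ?case
    proof (rule Suc.IH[of "\<lambda>n. c (Suc n)"])
      fix x :: real assume x: "0 < x" "x < 1"
      have "(\<lambda>n. c (Suc n) * x ^ Suc n) sums 0"
        unfolding sums_Suc_iff[where f="\<lambda>n. c n * x ^ n"]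
        using Suc.prems[OF x] zero[of c] Suc.prems by simp
      from sums_mult2[OF this, of "1 / x"] show "(\<lambda>n. c (Suc n) * x ^ n) sums 0"
        using x by simp
    qed
  qed
  show ?thesis
  proof
    fix n
    have "(\<lambda>n. (a n - b n) * x ^ n) sums 0" if "0 < x" "x < 1" for x
      using sums_diff[OF assms(1)[OF that] assms(2)[OF that]] by (simp add: left_diff_distrib)
    from zeros[of "\<lambda>n. a n - b n" n, OF this] show "a n = b n" by simp
  qed
qed

text \<open>Tonelli: with nonnegative terms the double family is summable over pairs, in either
  order.\<close>

lemma powser_exchange:
  fixes a :: "nat \<Rightarrow> nat \<Rightarrow> real"
  assumes a: "\<And>j k. 0 \<le> a j k" and x: "0 < x"
    and f: "\<And>j. (\<lambda>k. a j k * x ^ k) sums f j" and s: "summable f"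
  shows "summable (\<lambda>j. a j k)" and "(\<lambda>k. (\<Sum>j. a j k) * x ^ k) sums suminf f"
proof -
  have nn: "0 \<le> a j k * x ^ k" for j k using a x by simp
  have fj: "((\<lambda>k. a j k * x ^ k) has_sum f j) UNIV" for j
    by (rule sums_nonneg_imp_has_sum[OF f nn])
  have fnn: "0 \<le> f j" for j using sums_le[OF nn sums_zero f] .
  have fs: "(f has_sum suminf f) UNIV"
    by (rule sums_nonneg_imp_has_sum[OF summable_sums[OF s] fnn])
  have summ: "(\<lambda>(j, k). a j k * x ^ k) summable_on UNIV \<times> UNIV"
    by (rule summable_on_SigmaI[where g=f]) (use fj fs nn has_sum_imp_summable in auto)
  have hs: "((\<lambda>(j, k). a j k * x ^ k) has_sum suminf f) (UNIV \<times> UNIV)"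
    by (rule has_sum_SigmaI[where g=f]) (use fj fs summ in auto)
  have sk: "summable (\<lambda>j. a j k)" for k
  proof (rule summable_comparison_test'[OF summable_mult[OF s, of "inverse (x ^ k)"]])
    fix j
    have "a j k * x ^ k \<le> f j"
      using sum_le_suminf[OF sums_summable[OF f], of "{k}" j] nn sums_unique[OF f] by simp
    then show "norm (a j k) \<le> inverse (x ^ k) * f j"
      using a x by (simp add: field_simps)
  qed
  then show "summable (\<lambda>j. a j k)" .
  have "((\<lambda>(k, j). a j k * x ^ k) has_sum suminf f) (UNIV \<times> UNIV)"
    using iffD1[OF has_sum_swap hs] by (simp add: case_prod_unfold)
  then have "((\<lambda>k. (\<Sum>j. a j k) * x ^ k) has_sum suminf f) UNIV"
  proof (rule has_sum_SigmaD)
    fix k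
    show "((\<lambda>j. case (k, j) of (k, j) \<Rightarrow> a j k * x ^ k) has_sum (\<Sum>j. a j k) * x ^ k) UNIV"
      using sums_nonneg_imp_has_sum[OF sums_mult2[OF summable_sums[OF sk]] nn] by simp
  qed
  then show "(\<lambda>k. (\<Sum>j. a j k) * x ^ k) sums suminf f" by (rule has_sum_imp_sums)
qed

section \<open>Functions on (0,1) with Taylor coefficients in the adjoined ring\<close>

lemma rat_adjoin_sum: "(\<And>i. i \<in> A \<Longrightarrow> f i \<in> rat_adjoin S) \<Longrightarrow> sum f A \<in> rat_adjoin S"
  by (induction A rule: infinite_finite_induct) (auto intro: rat_adjoin.intros)

definition rat_series :: "real set \<Rightarrow> (real \<Rightarrow> real) set" where
  "rat_series S = {f. \<exists>c. (\<forall>k. c k \<in> rat_adjoin S) \<and>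
     (\<forall>x. 0 < x \<longrightarrow> x < 1 \<longrightarrow> (\<lambda>k. c k * x ^ k) sums f x)}"

lemma rat_seriesI:
  assumes "\<And>k. c k \<in> rat_adjoin S" "\<And>x. 0 < x \<Longrightarrow> x < 1 \<Longrightarrow> (\<lambda>k. c k * x ^ k) sums f x"
  shows "f \<in> rat_series S"
  using assms unfolding rat_series_def by blast

lemma rat_series_cong:
  assumes "f \<in> rat_series S" "\<And>x. 0 < x \<Longrightarrow> x < 1 \<Longrightarrow> f x = g x"
  shows "g \<in> rat_series S"
  using assms unfolding rat_series_def by simp

lemma rat_series_const: "r \<in> rat_adjoin S \<Longrightarrow> (\<lambda>x. r) \<in> rat_series S"
proof (rule rat_seriesI)
  fix x :: real
  show "(\<lambda>k. (if k = 0 then r else 0) * x ^ k) sums r"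
    using sums_single[of 0 "\<lambda>k. r * x ^ k"] by (simp add: if_distrib[of "\<lambda>c. c * _"] cong: if_cong)
qed (auto intro: rat_adjoin.rat)

lemma rat_series_add:
  assumes "f \<in> rat_series S" "g \<in> rat_series S"
  shows "(\<lambda>x. f x + g x) \<in> rat_series S"
proof -
  obtain c where c: "\<And>k. c k \<in> rat_adjoin S" "\<And>x. 0 < x \<Longrightarrow> x < 1 \<Longrightarrow> (\<lambda>k. c k * x ^ k) sums f x"
    using assms(1) unfolding rat_series_def by blast
  obtain d where d: "\<And>k. d k \<in> rat_adjoin S" "\<And>x. 0 < x \<Longrightarrow> x < 1 \<Longrightarrow> (\<lambda>k. d k * x ^ k) sums g x"
    using assms(2) unfolding rat_series_def by blast
  from c d show ?thesis
    by (intro rat_seriesI[of "\<lambda>k. c k + d k"]) (auto intro: rat_adjoin.add sums_add simp: distrib_right)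
qed

lemma rat_series_mult:
  assumes "f \<in> rat_series S" "g \<in> rat_series S"
  shows "(\<lambda>x. f x * g x) \<in> rat_series S"
proof -
  obtain c where c: "\<And>k. c k \<in> rat_adjoin S" "\<And>x. 0 < x \<Longrightarrow> x < 1 \<Longrightarrow> (\<lambda>k. c k * x ^ k) sums f x"
    using assms(1) unfolding rat_series_def by blast
  obtain d where d: "\<And>k. d k \<in> rat_adjoin S" "\<And>x. 0 < x \<Longrightarrow> x < 1 \<Longrightarrow> (\<lambda>k. d k * x ^ k) sums g x"
    using assms(2) unfolding rat_series_def by blast
  show ?thesis
  proof (rule rat_seriesI)
    show "(\<Sum>i\<le>k. c i * d (k - i)) \<in> rat_adjoin S" for k
      by (intro rat_adjoin_sum rat_adjoin.mult c d)
  next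
    fix x :: real assume x: "0 < x" "x < 1"
    \<comment> \<open>Convergence at the larger point \<open>y\<close> gives the absolute
      convergence at \<open>x\<close> required by the Cauchy product.\<close>
    then obtain y where y: "x < y" "y < 1" using dense by blast
    have "summable (\<lambda>k. norm (c k * x ^ k))" "summable (\<lambda>k. norm (d k * x ^ k))"
      by (rule powser_insidea[OF sums_summable[OF c(2)[of y]]] powser_insidea[OF sums_summable[OF d(2)[of y]]];
          use x y in simp)+
    from Cauchy_product_sums[OF this]
    have "(\<lambda>k. \<Sum>i\<le>k. c i * x ^ i * (d (k - i) * x ^ (k - i))) sums (f x * g x)"
      using c(2)[OF x] d(2)[OF x] by (simp add: sums_iff)
    moreover have "(\<Sum>i\<le>k. c i * x ^ i * (d (k - i) * x ^ (k - i))) = (\<Sum>i\<le>k. c i * d (k - i)) * x ^ k" for k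
      unfolding sum_distrib_right
      by (intro sum.cong refl) (simp add: mult_ac flip: power_add)
    ultimately show "(\<lambda>k. (\<Sum>i\<le>k. c i * d (k - i)) * x ^ k) sums (f x * g x)" by simp
  qed
qed

lemma rat_series_sum:
  "(\<And>i. i \<in> A \<Longrightarrow> f i \<in> rat_series S) \<Longrightarrow> (\<lambda>x. \<Sum>i\<in>A. f i x) \<in> rat_series S"
  by (induction A rule: infinite_finite_induct)
     (auto intro: rat_series_add rat_series_const[OF rat_adjoin.rat[OF Rats_0]])

abbreviation zetas :: "real set" where
  "zetas \<equiv> {zeta_value k | k. k \<ge> 2}"

section \<open>Expansions of shifted zeta sums and of the weights\<close>

lemma weight_sums:
  assumes "\<bar>z\<bar> < 1"
  shows "(\<lambda>k. weight a k * z ^ k) sums (1 - z) powr (- a)"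
proof -
  have "(\<lambda>k. (- a gchoose k) * (- z) ^ k) sums (1 + - z) powr (- a)"
    by (rule gen_binomial_real) (use assms in simp)
  moreover have "(- a gchoose k) * (- z) ^ k = weight a k * z ^ k" for k
    by (simp add: gbinomial_pochhammer weight_def power_minus[of z])
  ultimately show ?thesis by simp
qed

text \<open>From \<open>j = 1\<close> on the base is at least \<open>j\<close>; the first base, 1 -
  x, can be arbitrarily small and is split off.\<close>

lemma summable_shifted_zeta:
  fixes x :: real
  assumes "0 \<le> x" "x < 1" "2 \<le> s"
  shows "summable (\<lambda>j. 1 / (real j + 1 - x) ^ s)"
proof -
  have "summable (\<lambda>j. 1 / (real (Suc j) + 1 - x) ^ s)"
  proof (rule summable_comparison_test')
    show "summable (\<lambda>j. inverse (real (Suc j) ^ s))"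
      using inverse_power_summable[OF assms(3), where 'a=real] by (subst summable_Suc_iff) simp
  next
    fix j
    have "real (Suc j) ^ s \<le> (real (Suc j) + 1 - x) ^ s"
      using assms by (intro power_mono) auto
    then show "norm (1 / (real (Suc j) + 1 - x) ^ s) \<le> inverse (real (Suc j) ^ s)"
      using assms by (simp add: inverse_eq_divide frac_le)
  qed
  then show ?thesis using summable_Suc_iff[where f="\<lambda>j. 1 / (real j + 1 - x) ^ s"] by simp
qed

text \<open>The binomial series in x/(j+1), summed over \<open>j\<close>, has as k-th coefficient
  binom(s+k-1, k) times \<open>zeta_value (s + k)\<close>.\<close>

lemma shifted_zeta_rat_series:
  assumes s: "2 \<le> s"
  shows "(\<lambda>x. \<Sum>j. 1 / (real j + 1 - x) ^ s) \<in> rat_series zetas"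
proof -
  define a where "a j k = weight (real s) k / real (Suc j) ^ (s + k)" for j k
  have a: "0 \<le> a j k" for j k by (simp add: a_def weight_nonneg)
  have sums: "(\<lambda>k. a j k * x ^ k) sums (1 / (real j + 1 - x) ^ s)" if x: "0 < x" "x < 1" for j x
  proof -
    let ?z = "x / real (Suc j)"
    have "\<bar>?z\<bar> < 1" using x by (simp add: field_simps)
    from sums_divide[OF weight_sums[OF this, of "real s"], of "real (Suc j) ^ s"]
    have "(\<lambda>k. a j k * x ^ k) sums ((1 - ?z) powr (- real s) / real (Suc j) ^ s)"
      by (simp add: a_def power_divide power_add mult_ac del: of_nat_Suc)
    also have "1 - ?z = (real j + 1 - x) / real (Suc j)" by (simp add: field_simps)
    also have "\<dots> powr (- real s) / real (Suc j) ^ s = 1 / (real j + 1 - x) ^ s"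
    proof -
      have "0 < (real j + 1 - x) / real (Suc j)" using x by simp
      then show ?thesis
        by (simp add: powr_minus powr_realpow power_divide inverse_eq_divide del: of_nat_Suc)
    qed
    finally show ?thesis .
  qed
  have "(\<Sum>j. a j k) = weight (real s) k * zeta_value (s + k)" for k
  proof -
    have "summable (\<lambda>j. 1 / real (Suc j) ^ (s + k))"
      using summable_shifted_zeta[of 0 "s + k"] s by (simp add: add.commute)
    from suminf_mult[OF this, of "weight (real s) k"] show ?thesis
      by (simp add: a_def zeta_value_def)
  qed
  moreover have "weight (real s) k \<in> \<rat>" for k
  proof -
    have "weight (real s) k = real (pochhammer s k) / real (fact k)"
      by (simp add: weight_def pochhammer_of_nat)
    then show ?thesis by (simp only: Rats_divide Rats_of_nat)
  qed
  ultimately have "(\<Sum>j. a j k) \<in> rat_adjoin zetas" for k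
    using s by (auto intro!: rat_adjoin.mult[OF rat_adjoin.rat rat_adjoin.gen])
  then show ?thesis
  proof (rule rat_seriesI)
    fix x :: real assume x: "0 < x" "x < 1"
    show "(\<lambda>k. (\<Sum>j. a j k) * x ^ k) sums (\<Sum>j. 1 / (real j + 1 - x) ^ s)"
      by (rule powser_exchange(2)[OF a x(1) sums[OF x] summable_shifted_zeta]) (use x s in auto)
  qed
qed

lemma sums_shift:
  fixes f :: "nat \<Rightarrow> real"
  shows "f sums s \<Longrightarrow> (\<lambda>k. case k of 0 \<Rightarrow> 0 | Suc r \<Rightarrow> f r) sums s"
  using sums_Suc[of "\<lambda>k. case k of 0 \<Rightarrow> 0 | Suc r \<Rightarrow> f r" s] by simp

text \<open>\<open>weight x (Suc n)\<close> is x/(n+1) times the product of 1 + x/j over j \<le> n,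
  whose coefficients are the elementary symmetric functions of the 1/j. The factor \<open>x\<close>
  moves \<open>r\<close> ones to degree \<open>r + 1\<close>.\<close>

lemma weight_Suc_sums:
  "(\<lambda>k. (case k of 0 \<Rightarrow> 0 | Suc r \<Rightarrow> mhs n (replicate r 1) / (real n + 1)) * x ^ k) sums weight x (Suc n)"
proof -
  have "(\<lambda>r. mhs n (replicate r 1) * x ^ r) sums (\<Prod>j = 1..n. 1 + x / real j)"
  proof (induction n)
    case 0
    have "(\<lambda>r. mhs 0 (replicate r 1) * x ^ r) = (\<lambda>r. if r = 0 then 1 else 0)"
      by (auto simp: fun_eq_iff gr0_conv_Suc mhs_Cons)
    then show ?case using sums_single[of 0 "\<lambda>_. 1::real"] by simp
  next
    case (Suc n)
    have "(\<lambda>r. case r of 0 \<Rightarrow> 0 | Suc r \<Rightarrow> mhs n (replicate r 1) * x ^ r * (x / (real n + 1)))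
        sums ((\<Prod>j = 1..n. 1 + x / real j) * (x / (real n + 1)))"
      by (intro sums_shift sums_mult2 Suc.IH)
    from sums_add[OF Suc.IH this]
    have "(\<lambda>r. mhs n (replicate r 1) * x ^ r + (case r of 0 \<Rightarrow> 0 | Suc r \<Rightarrow> mhs n (replicate r 1) * x ^ r * (x / (real n + 1))))
        sums (\<Prod>j = 1..Suc n. 1 + x / real j)"
      by (simp add: algebra_simps)
    moreover have "mhs n (replicate r 1) * x ^ r + (case r of 0 \<Rightarrow> 0 | Suc r \<Rightarrow> mhs n (replicate r 1) * x ^ r * (x / (real n + 1)))
        = mhs (Suc n) (replicate r 1) * x ^ r" for r
      by (cases r) (auto simp: mhs_Cons field_simps)
    ultimately show ?case by simp
  qed
  from sums_mult2[OF this, of "x / (real n + 1)"]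
  have "(\<lambda>k. mhs n (replicate k 1) / (real n + 1) * x ^ Suc k) sums ((\<Prod>j = 1..n. 1 + x / real j) * (x / (real n + 1)))"
    by (simp add: mult_ac)
  also have "(\<Prod>j = 1..n. 1 + x / real j) * (x / (real n + 1)) = weight x (Suc n)"
  proof (induction n)
    case 0
    then show ?case using weight_Suc[of 0 x] by simp
  next
    case (Suc n)
    have "weight x (Suc (Suc n)) = weight x (Suc n) * ((real n + 1 + x) / (real n + 2))"
      using weight_Suc[of "Suc n" x] by (simp add: field_simps)
    also have "\<dots> = (\<Prod>j = 1..n. 1 + x / real j) * (x / (real n + 1)) * ((real n + 1 + x) / (real n + 2))"
      by (simp only: Suc.IH)
    also have "\<dots> = (\<Prod>j = 1..n. 1 + x / real j) * ((real n + 1 + x) / (real n + 1)) * (x / (real n + 2))"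
      by simp
    also have "(real n + 1 + x) / (real n + 1) = 1 + x / real (Suc n)" by (simp add: divide_simps) (simp add: algebra_simps)
    finally show ?case by (simp add: add.commute)
  qed
  finally show ?thesis
    by (rule sums_cong[THEN iffD1, rotated, OF sums_shift]) (simp split: nat.split)
qed

text \<open>The moments of the unit mass at t = 0; every weighted row sum is 1.\<close>

definition delta :: "nat \<Rightarrow> nat \<Rightarrow> real" where
  "delta j i = (if i = 0 then 1 else 0)"

section \<open>The interpolating Newton series\<close>

text \<open>Row \<open>0\<close> of \<open>tower m q\<close> is \<open>mhs_star n ls / n\<close> for the index \<open>ls\<close> of the theorem
  with \<open>p = q + 1\<close>, see \<open>tower_row\<close>.\<close>

fun tower :: "nat \<Rightarrow> nat \<Rightarrow> nat \<Rightarrow> nat \<Rightarrow> real" where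
  "tower m 0 = (cesaro ^^ Suc m) delta"
| "tower m (Suc q) = (cesaro ^^ m) (cesaro_dual (tower m q))"

lemma dtable_delta: "dtable delta"
  by (simp add: dtable_def delta_def)

lemma dtable_cesaro_pow: "dtable a \<Longrightarrow> dtable ((cesaro ^^ n) a)"
  by (induction n) (auto intro: dtable_cesaro)

lemma dtable_tower: "dtable (tower m q)"
  by (induction q) (auto intro!: dtable_cesaro_pow dtable_cesaro dtable_cesaro_dual dtable_delta)

text \<open>The coefficient 1 stands in for a table preceding \<open>tower m 0\<close>, so that one
  recursion covers all degrees.\<close>

definition newton_fps :: "real \<Rightarrow> nat \<Rightarrow> nat \<Rightarrow> real fps" where
  "newton_fps x m j = Abs_fps (\<lambda>p. case p of 0 \<Rightarrow> 1 | Suc q \<Rightarrow> newton x (tower m q) j)"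

context
  fixes x :: real
  assumes x: "0 \<le> x" "x < 1"
begin

lemma summable_delta: "summable (\<lambda>i. weight x i * delta j i)"
  by (rule summable_finite[of "{0}"]) (auto simp: delta_def)

lemma weighted_cesaro_pow:
  assumes a: "dtable a" and s: "summable (\<lambda>i. weight x i * a j i)"
  shows "summable (\<lambda>i. weight x i * (cesaro ^^ n) a j i)
    \<and> (real j + 1 - x) ^ n * (\<Sum>i. weight x i * (cesaro ^^ n) a j i) = (\<Sum>i. weight x i * a j i)"
proof (induction n)
  case 0
  then show ?case using s by simp
next
  case (Suc n)
  note w = weighted_cesaro[OF x dtable_cesaro_pow[OF a] conjunct1[OF Suc.IH]]
  have "(real j + 1 - x) ^ Suc n * (\<Sum>i. weight x i * (cesaro ^^ Suc n) a j i)
      = (real j + 1 - x) ^ n * ((real j + 1 - x) * (\<Sum>i. weight x i * cesaro ((cesaro ^^ n) a) j i))"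
    by simp
  also have "\<dots> = (\<Sum>i. weight x i * a j i)" unfolding w(2) using Suc.IH by simp
  finally show ?case using w(1) by simp
qed

lemma summable_tower: "summable (\<lambda>i. weight x i * tower m q j i)"
proof (induction q arbitrary: j)
  case 0
  show ?case unfolding tower.simps
    by (rule conjunct1[OF weighted_cesaro_pow[OF dtable_delta summable_delta]])
next
  case (Suc q)
  show ?case unfolding tower.simps
    by (rule conjunct1[OF weighted_cesaro_pow[OF dtable_cesaro_dual[OF dtable_tower]
          weighted_cesaro_dual(1)[OF x dtable_tower Suc.IH]]])
qed

text \<open>Each level of the tower consists of \<open>m + 1\<close> operations, and each
  contributes one factor \<open>j + 1 - x\<close>.\<close>

lemma weighted_tower:
  "(real j + 1 - x) ^ Suc m * (\<Sum>i. weight x i * tower m q j i) = newton_fps x m (Suc j) $ q"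
proof (cases q)
  case 0
  have "(\<Sum>i. weight x i * delta j i) = 1"
    by (subst suminf_finite[of "{0}"]) (auto simp: delta_def)
  then show ?thesis
    unfolding 0 tower.simps conjunct2[OF weighted_cesaro_pow[OF dtable_delta summable_delta]]
    by (simp add: newton_fps_def)
next
  case (Suc k)
  note d = weighted_cesaro_dual[OF x dtable_tower[of m k] summable_tower, of j]
  have "(real j + 1 - x) ^ Suc m * (\<Sum>i. weight x i * tower m q j i)
      = (real j + 1 - x) * ((real j + 1 - x) ^ m * (\<Sum>i. weight x i * (cesaro ^^ m) (cesaro_dual (tower m k)) j i))"
    by (simp add: Suc mult_ac)
  also have "\<dots> = newton x (tower m k) (Suc j)"
    unfolding conjunct2[OF weighted_cesaro_pow[OF dtable_cesaro_dual[OF dtable_tower] d(1)]] by (rule d(2))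
  finally show ?thesis by (simp add: newton_fps_def Suc)
qed

text \<open>The increment of a Newton series is a weighted row sum, which
  \<open>weighted_tower\<close> reduces to the preceding coefficient.\<close>

lemma newton_fps_Suc:
  "newton_fps x m (Suc j) * (1 - fps_const (1 / (real j + 1 - x) ^ Suc m) * fps_X) = newton_fps x m j"
proof (rule fps_ext)
  fix p
  show "(newton_fps x m (Suc j) * (1 - fps_const (1 / (real j + 1 - x) ^ Suc m) * fps_X)) $ p = newton_fps x m j $ p"
  proof (cases p)
    case 0
    then show ?thesis by (simp add: newton_fps_def)
  next
    case (Suc q)
    let ?c = "1 / (real j + 1 - x) ^ Suc m" and ?F = "newton_fps x m (Suc j)"
    have "(?F * (1 - fps_const ?c * fps_X)) $ p = ?F $ p - ?c * ?F $ q"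
    proof -
      have "?F * (1 - fps_const ?c * fps_X) = ?F - fps_const ?c * (?F * fps_X)"
        by (simp add: right_diff_distrib mult_ac del: power_Suc)
      then show ?thesis by (simp add: Suc del: power_Suc)
    qed
    also have "?c * ?F $ q = (\<Sum>i. weight x i * tower m q j i)"
      using x by (auto simp: weighted_tower[symmetric] simp del: power_Suc)
    finally show ?thesis by (simp add: newton_fps_def Suc newton_def)
  qed
qed

end

text \<open>Since \<open>m \<ge> 1\<close>, a mean is applied after every
  \<open>cesaro_dual\<close>; this outermost mean supplies the decay in \<open>j\<close>.\<close>

lemma tower_cesaro:
  assumes "1 \<le> m"
  obtains v where "tower m q = cesaro v" "dtable v"
    "\<And>x. 0 \<le> x \<Longrightarrow> x < 1 \<Longrightarrow> summable (\<lambda>i. weight x i * v 0 i)"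
proof (cases q)
  case 0
  show ?thesis
    by (rule that[of "(cesaro ^^ m) delta"])
       (simp_all add: 0 dtable_cesaro_pow dtable_delta weighted_cesaro_pow summable_delta)
next
  case (Suc k)
  obtain n where n: "m = Suc n" using assms by (cases m) auto
  show ?thesis
    by (rule that[of "(cesaro ^^ n) (cesaro_dual (tower m k))"])
       (simp_all add: Suc n dtable_cesaro_pow dtable_cesaro_dual dtable_tower weighted_cesaro_pow
         weighted_cesaro_dual(1) summable_tower)
qed

lemma newton_zero:
  assumes "dtable a" "summable (\<lambda>i. weight 0 i * a 0 i)"
  shows "newton 0 a j = (\<Sum>k<j. a k 0)"
  using newton_eq[of 0 a j] assms by simp

text \<open>The difference is a tail series dominated by the weighted row sum, which \<open>weighted_cesaro\<close>
  makes of order \<open>1 / j\<close>.\<close>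

lemma newton_tower_limit:
  assumes m: "1 \<le> m" and x: "0 \<le> x" "x < 1"
  shows "(\<lambda>j. newton x (tower m q) j - newton 0 (tower m q) j) \<longlonglongrightarrow> 0"
proof -
  let ?a = "tower m q"
  obtain v where v: "?a = cesaro v" "dtable v" "\<And>x. 0 \<le> x \<Longrightarrow> x < 1 \<Longrightarrow> summable (\<lambda>i. weight x i * v 0 i)"
    using tower_cesaro[OF m, of q] by metis
  note sv = v(3)[OF x]
  let ?V = "\<Sum>i. weight x i * v 0 i"
  have bound: "norm (newton x ?a j - newton 0 ?a j) \<le> ?V / (real j + 1 - x)" for j
  proof -
    note svj = summable_weight_row[OF x v(2) sv, of j]
    note aw = weighted_cesaro[OF x v(2) svj, folded v(1)]
    note ss = summable_weight_Suc[OF x dtable_tower[of m q] summable_tower[OF x], of j]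
    have pos: "0 < real j + 1 - x" using x by simp
    have eq: "newton x ?a j - newton 0 ?a j = - (\<Sum>i. weight x (Suc i) * ?a j i)"
      unfolding newton_eq[OF x dtable_tower summable_tower[OF x]]
      by (subst newton_zero[OF dtable_tower summable_tower]) auto
    have nn: "0 \<le> weight x (Suc i) * ?a j i" for i
      using x by (simp add: weight_nonneg dtableD(1)[OF dtable_tower])
    have "(\<Sum>i. weight x (Suc i) * ?a j i) \<le> (\<Sum>i. weight x i * ?a j i)"
      by (intro suminf_le ss aw(1) mult_right_mono weight_Suc_le x dtableD(1)[OF dtable_tower])
    also have "\<dots> = (\<Sum>i. weight x i * v j i) / (real j + 1 - x)"
      using aw(2) pos by (simp add: field_simps)
    also have "\<dots> \<le> ?V / (real j + 1 - x)"
      using pos by (intro divide_right_mono suminf_le svj sv mult_left_mono weight_nonneg x dtable_le_0 v(2)) simp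
    finally show ?thesis using suminf_nonneg[OF ss nn] unfolding eq by simp
  qed
  have "(\<lambda>j. ?V / (real j + 1 - x)) \<longlonglongrightarrow> 0"
  proof (rule tendsto_divide_0[OF tendsto_const filterlim_at_top_imp_at_infinity])
    have "filterlim (\<lambda>j. (1 - x) + real j) at_top sequentially"
      by (rule filterlim_tendsto_add_at_top[OF tendsto_const filterlim_real_sequentially])
    then show "filterlim (\<lambda>j. real j + 1 - x) at_top sequentially" by (simp add: algebra_simps)
  qed
  then show ?thesis by (rule Lim_null_comparison[rotated]) (use bound in simp)
qed

lemma newton_fps_zero: "newton_fps 0 m 0 = 1"
  by (rule fps_ext) (simp add: newton_fps_def newton_def split: nat.split)

lemma newton_fps_identity:
  assumes m: "1 \<le> m" and x: "0 \<le> x" "x < 1"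
  shows "real p * newton_fps x m 0 $ p = (\<Sum>i = 1..p.
    (zeta_value (Suc m * i) - (\<Sum>j. 1 / (real j + 1 - x) ^ (Suc m * i))) * newton_fps x m 0 $ (p - i))"
proof (rule newton_identity_limit[where F="newton_fps x m" and E="newton_fps 0 m"
      and b="\<lambda>j. 1 / (real j + 1 - x) ^ Suc m" and a="\<lambda>j. 1 / (real j + 1 - 0) ^ Suc m"])
  show "newton_fps x m (Suc j) * (1 - fps_const (1 / (real j + 1 - x) ^ Suc m) * fps_X) = newton_fps x m j" for j
    by (rule newton_fps_Suc[OF x])
  show "newton_fps 0 m (Suc j) * (1 - fps_const (1 / (real j + 1 - 0) ^ Suc m) * fps_X) = newton_fps 0 m j" for j
    by (rule newton_fps_Suc) auto
  show "newton_fps 0 m 0 = 1" by (rule newton_fps_zero)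
  show "(\<lambda>j. newton_fps x m j $ p - newton_fps 0 m j $ p) \<longlonglongrightarrow> 0" for p
    using newton_tower_limit[OF m x] by (cases p) (auto simp: newton_fps_def)
  show "summable (\<lambda>j. 1 / (real j + 1 - x) ^ Suc m)"
    using m by (intro summable_shifted_zeta x) simp
  show "0 \<le> 1 / (real j + 1 - x) ^ Suc m" for j using x by (simp del: power_Suc)
  show "(\<lambda>j. (1 / (real j + 1 - 0) ^ Suc m) ^ i - (1 / (real j + 1 - x) ^ Suc m) ^ i)
      sums (zeta_value (Suc m * i) - (\<Sum>j. 1 / (real j + 1 - x) ^ (Suc m * i)))" if "1 \<le> i" for i
  proof -
    \<comment> \<open>With exponent at least 2 the two power sums converge separately.\<close>
    have "2 * 1 \<le> Suc m * i" using m that by (intro mult_le_mono) auto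
    then have i: "2 \<le> Suc m * i" by simp
    have "(\<lambda>j. 1 / (real j + 1 - 0) ^ (Suc m * i)) sums zeta_value (Suc m * i)"
      using summable_sums[OF summable_shifted_zeta[OF _ _ i, of 0]]
      by (simp add: zeta_value_def add.commute)
    from sums_diff[OF this summable_sums[OF summable_shifted_zeta[OF x i]]]
    show ?thesis by (simp only: power_one_over power_mult[symmetric])
  qed
qed

lemma newton_fps_rat_series:
  assumes m: "1 \<le> m"
  shows "(\<lambda>x. newton_fps x m 0 $ p) \<in> rat_series zetas"
proof (induction p rule: less_induct)
  case (less p)
  show ?case
  proof (cases "p = 0")
    case True
    then show ?thesis
      using rat_series_const[OF rat_adjoin.rat[OF Rats_1]] by (simp add: newton_fps_def)
  next
    case False
    have "(\<lambda>x. (1 / real p) * (\<Sum>i = 1..p. (zeta_value (Suc m * i) + (- 1) * (\<Sum>j. 1 / (real j + 1 - x) ^ (Suc m * i)))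
        * newton_fps x m 0 $ (p - i))) \<in> rat_series zetas"
    proof (intro rat_series_mult rat_series_sum rat_series_add rat_series_const)
      fix i assume i: "i \<in> {1..p}"
      have "2 * 1 \<le> Suc m * i" using m i by (intro mult_le_mono) auto
      then have i2: "2 \<le> Suc m * i" by simp
      show "zeta_value (Suc m * i) \<in> rat_adjoin zetas"
        using i2 by (intro rat_adjoin.gen) blast
      show "(\<lambda>x. \<Sum>j. 1 / (real j + 1 - x) ^ (Suc m * i)) \<in> rat_series zetas"
        by (rule shifted_zeta_rat_series[OF i2])
      show "(\<lambda>x. newton_fps x m 0 $ (p - i)) \<in> rat_series zetas"
        using i by (intro less.IH) auto
    qed (auto intro!: rat_adjoin.rat)
    then show ?thesis
    proof (rule rat_series_cong)
      fix x :: real assume "0 < x" "x < 1"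
      then show "(1 / real p) * (\<Sum>i = 1..p. (zeta_value (Suc m * i) + (- 1) * (\<Sum>j. 1 / (real j + 1 - x) ^ (Suc m * i)))
        * newton_fps x m 0 $ (p - i)) = newton_fps x m 0 $ p"
        using newton_fps_identity[OF m, of x p] False by (simp add: field_simps del: mult_Suc)
    qed
  qed
qed

section \<open>Row 0 of the tower as star sums\<close>

lemma cesaro_row:
  assumes "\<And>i. a 0 i = mhs_star (Suc i) ks / real (Suc i) ^ k"
  shows "cesaro a 0 i = mhs_star (Suc i) (k # ks) / real (Suc i)"
proof (induction i)
  case 0
  then show ?case by (simp add: assms mhs_star_Cons)
next
  case (Suc i)
  have "cesaro a 0 (Suc i) = (real (Suc i) * cesaro a 0 i + a 0 (Suc i)) / real (Suc (Suc i))"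
    by (simp add: add.commute)
  also have "\<dots> = (mhs_star (Suc i) (k # ks) + a 0 (Suc i)) / real (Suc (Suc i))"
    unfolding Suc.IH by simp
  also have "mhs_star (Suc i) (k # ks) + a 0 (Suc i) = mhs_star (Suc (Suc i)) (k # ks)"
    by (simp add: assms mhs_star_Cons)
  finally show ?case .
qed

lemma cesaro_pow_row:
  assumes "\<And>i. a 0 i = mhs_star (Suc i) ks / real (Suc i) ^ k"
  shows "(cesaro ^^ Suc n) a 0 i = mhs_star (Suc i) (replicate n 1 @ k # ks) / real (Suc i)"
proof (induction n arbitrary: i)
  case 0
  show ?case using cesaro_row[of a ks k, OF assms] by simp
next
  case (Suc n)
  show ?case using cesaro_row[of "(cesaro ^^ Suc n) a" "replicate n 1 @ k # ks" 1] Suc.IH by simp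
qed

lemma rep_singleton: "rep n [k] = replicate n k"
  by (induction n) auto

text \<open>A mean turns the exponent of the outer denominator into a new first entry and leaves the
  denominator \<open>n\<close>. That entry is 1 after another mean, and 2 after
  \<open>cesaro_dual\<close>, which squares the denominator.\<close>

lemma tower_row:
  "tower (Suc m) q 0 i
    = mhs_star (Suc i) (rep q (rep m [1] @ [2]) @ rep (Suc m) [1]) / real (Suc i)"
proof (induction q arbitrary: i)
  case 0
  \<comment> \<open>The means of 1, 0, 0, ... are 1/n. The first mean is spent on this; the
    remaining ones give \<open>Suc m\<close> ones.\<close>
  have "cesaro delta 0 i = mhs_star (Suc i) [] / real (Suc i) ^ 1" for i
  proof (induction i)
    case (Suc i)
    then show ?case by (simp add: delta_def) (simp add: divide_simps, simp add: algebra_simps)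
  qed (simp add: delta_def)
  from cesaro_pow_row[of "cesaro delta", OF this, of m i]
  show ?case by (simp add: rep_singleton funpow_swap1 replicate_append_same del: rep_simps(2) cesaro.simps)
next
  case (Suc q)
  have "cesaro_dual (tower (Suc m) q) 0 i
      = mhs_star (Suc i) (rep q (rep m [1] @ [2]) @ rep (Suc m) [1]) / real (Suc i) ^ 2" for i
    by (simp add: cesaro_dual_0 Suc.IH power2_eq_square add.commute del: rep_simps)
  from cesaro_pow_row[of "cesaro_dual (tower (Suc m) q)", OF this, of m i]
  show ?case by (simp add: rep_singleton)
qed

theorem theorem3p6:
  fixes r m p :: nat
  assumes "r \<ge> 1" and "m \<ge> 1" and "p \<ge> 1"
  defines "ls \<equiv> rep (p - 1) (rep (m - 1) [1] @ [2]) @ rep m [1]"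
  shows "(\<lambda>n. mhs (Suc n - 1) (rep (r - 1) [1]) * mhs_star (Suc n) ls / real (Suc n) ^ 2)
           sums ky_mzv (rep r [1]) (1 # ls)
         \<and> ky_mzv (rep r [1]) (1 # ls) \<in> rat_adjoin {zeta_value k | k. k \<ge> 2}"
proof -
  obtain r' where r': "r = Suc r'" using assms(1) by (cases r) auto
  have m': "m = Suc (m - 1)" using assms(2) by simp
  let ?t = "tower m (p - 1)"
  \<comment> \<open>\<open>e k n\<close> is the coefficient of x^k in
    \<open>weight x (Suc n)\<close>; it and \<open>?t\<close> each carry one of the two factors
    1/n.\<close>
  define e where "e k n = (case k of 0 \<Rightarrow> 0 | Suc r \<Rightarrow> mhs n (replicate r 1) / (real n + 1))" for k n
  have t: "?t 0 n = mhs_star (Suc n) ls / real (Suc n)" for n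
    using tower_row[of "m - 1" "p - 1" n] unfolding ls_def m'[symmetric] .
  have e_nonneg: "0 \<le> e k n" for k n
    by (auto simp: e_def mhs_def intro!: sum_nonneg prod_nonneg divide_nonneg_nonneg split: nat.split)
  have sums_e: "(\<lambda>k. e k n * ?t 0 n * x ^ k) sums (weight x (Suc n) * ?t 0 n)" for n x
    using sums_mult2[OF weight_Suc_sums[of n x], of "?t 0 n"] by (simp add: e_def mult_ac)
  have nonneg: "0 \<le> e k n * ?t 0 n" for k n
    by (intro mult_nonneg_nonneg e_nonneg dtableD(1)[OF dtable_tower])
  have summable_t: "summable (\<lambda>n. weight x (Suc n) * ?t 0 n)" if "0 \<le> x" "x < 1" for x
    by (rule summable_weight_Suc[OF that dtable_tower summable_tower[OF that]])
  \<comment> \<open>At \<open>j = 0\<close> there are no increments, and the Newton series is minus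
    the weighted sum.\<close>
  have newton: "(\<Sum>n. weight x (Suc n) * ?t 0 n) = (- 1) * newton_fps x m 0 $ p" for x
    using assms(3) by (auto simp: newton_fps_def newton_def split: nat.split)
  \<comment> \<open>Convergence at a single positive point such as 1/2 suffices for every
    coefficient.\<close>
  have summable_e: "summable (\<lambda>n. e k n * ?t 0 n)" for k
    by (rule powser_exchange(1)[OF nonneg _ sums_e[of _ "1/2"] summable_t]) auto
  have series: "(\<lambda>k. (\<Sum>n. e k n * ?t 0 n) * x ^ k) sums ((- 1) * newton_fps x m 0 $ p)" if "0 < x" "x < 1" for x
    unfolding newton[symmetric]
    by (rule powser_exchange(2)[OF nonneg that(1) sums_e summable_t]) (use that in auto)
  have "(\<lambda>x. (- 1) * newton_fps x m 0 $ p) \<in> rat_series zetas"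
    by (intro rat_series_mult rat_series_const newton_fps_rat_series assms(2) rat_adjoin.rat) simp
  then obtain c where c: "\<And>k. c k \<in> rat_adjoin zetas"
    "\<And>x. 0 < x \<Longrightarrow> x < 1 \<Longrightarrow> (\<lambda>k. c k * x ^ k) sums ((- 1) * newton_fps x m 0 $ p)"
    unfolding rat_series_def by blast
  \<comment> \<open>Membership in \<open>rat_series\<close> only provides some expansion; uniqueness
    identifies its coefficients with the sums wanted.\<close>
  have "(\<lambda>k. \<Sum>n. e k n * ?t 0 n) = c"
    by (rule powser_unique[OF series c(2)])
  then have mem: "(\<Sum>n. e r n * ?t 0 n) \<in> rat_adjoin zetas"
    using c(1)[of r] by (simp add: fun_eq_iff)
  have term_eq: "e r n * ?t 0 n = mhs (Suc n - 1) (rep (r - 1) [1]) * mhs_star (Suc n) ls / real (Suc n) ^ 2" for n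
    unfolding t by (simp add: e_def r' rep_singleton power2_eq_square add.commute)
  have "ky_term (rep r [1]) (1 # ls) (Suc n) = e r n * ?t 0 n" for n
    unfolding term_eq by (simp add: ky_term_def r' power2_eq_square)
  then have ky: "ky_mzv (rep r [1]) (1 # ls) = (\<Sum>n. e r n * ?t 0 n)"
    by (simp add: ky_mzv_def)
  show ?thesis
    using summable_sums[OF summable_e[of r]] mem unfolding ky term_eq by blast
qed

end
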